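(* Let $n\ge 1$ be an integer. For all real numbers $a_1,\dots,a_n$ and all real $x\ge 0$, $$\sum_{j=0}^{n-1}\Big(\sum_{k=0}^{j}\frac{x^k}{k!}\,a_{n-j+k}\Big)^2\le \exp\Big(2x\cos\frac{\pi}{n+1}\Big)\sum_{j=1}^n a_j^2 .$$
   Context: The convention $x^0=1$ is used, including at $x=0$. *)

theory Defs
  imports Complex_Main
begin

end

theory Submission
  imports Defs
begin

text \<open>
  With \<open>b i x = (\<Sum>k\<le>n-i. x ^ k / k! * a (i + k))\<close> the left-hand side is \<open>E x = (\<Sum>i=1..n. (b i x)\<^sup>2)\<close>.
  Since \<open>b i\<close> has derivative \<open>b (i + 1)\<close>, and \<open>b (n + 1) = 0\<close>, the derivative of \<open>E\<close> is
  \<open>2 (\<Sum>i<n. b i * b (i + 1))\<close>. This is at most \<open>2 cos (pi / (n + 1)) E\<close>, as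
  \<open>2 cos (pi / (n + 1))\<close> is the largest eigenvalue of the adjacency matrix of the path with
  \<open>n\<close> vertices; hence \<open>E x * exp (- 2 x cos (pi / (n + 1)))\<close> is nonincreasing.
\<close>

lemma weighted_am_gm:
  fixes u v y z :: real
  assumes "u > 0" "v > 0"
  shows "2 * y * z \<le> v / u * y\<^sup>2 + u / v * z\<^sup>2"
proof -
  have "v / u * y\<^sup>2 + u / v * z\<^sup>2 - 2 * y * z = (v * y - u * z)\<^sup>2 / (u * v)"
    using assms by (simp add: field_simps power2_eq_square)
  also have "\<dots> \<ge> 0"
    using assms by simp
  finally show ?thesis by simp
qed

text \<open>The eigenvector equation of the path: neighbours of \<open>sin (i * t)\<close> add up to
  \<open>2 * cos t\<close> times the middle entry.\<close>

lemma sin_neighbours: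
  fixes t :: real
  shows "sin (real m * t) + sin (real (m + 2) * t) = 2 * cos t * sin (real (m + 1) * t)"
proof -
  have "real m * t = real (m + 1) * t - t" "real (m + 2) * t = real (m + 1) * t + t"
    by (simp_all add: algebra_simps)
  then show ?thesis
    by (simp only: sin_add sin_diff) simp
qed

text \<open>
  The weights come from the positive eigenvector \<open>sin (i * t)\<close> of the path; the last term is the
  part of the square of \<open>y (m + 1)\<close> already spent, which makes the induction go through.
\<close>

lemma path_form_le_aux:
  fixes y :: "nat \<Rightarrow> real" and t :: real
  assumes "\<And>i. 1 \<le> i \<Longrightarrow> i \<le> m + 1 \<Longrightarrow> sin (real i * t) > 0"
  shows "(\<Sum>i=1..m. 2 * y i * y (i + 1))
     \<le> 2 * cos t * (\<Sum>i=1..m. (y i)\<^sup>2) + sin (real m * t) / sin (real (m + 1) * t) * (y (m + 1))\<^sup>2"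
  using assms
proof (induction m)
  case 0
  then show ?case by simp
next
  case (Suc m)
  let ?s = "\<lambda>i. sin (real i * t)"
  have pos: "?s (m + 1) > 0" "?s (m + 2) > 0"
    using Suc.prems[of "m + 1"] Suc.prems[of "m + 2"] by simp_all
  have "?s m / ?s (m + 1) + ?s (m + 2) / ?s (m + 1) = (2 * cos t * ?s (m + 1)) / ?s (m + 1)"
    unfolding sin_neighbours[symmetric] by (rule add_divide_distrib[symmetric])
  also have "\<dots> = 2 * cos t"
    using pos by simp
  finally have ratio: "?s m / ?s (m + 1) = 2 * cos t - ?s (m + 2) / ?s (m + 1)"
    by simp
  have IH: "(\<Sum>i=1..m. 2 * y i * y (i + 1))
      \<le> 2 * cos t * (\<Sum>i=1..m. (y i)\<^sup>2) + ?s m / ?s (m + 1) * (y (m + 1))\<^sup>2"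
    using Suc.prems by (intro Suc.IH) simp
  \<comment> \<open>By \<open>ratio\<close>, this weight on the square of \<open>y (m + 1)\<close>
    tops up the remainder in \<open>IH\<close> to exactly \<open>2 * cos t\<close>.\<close>
  have "2 * y (m + 1) * y (m + 2)
      \<le> ?s (m + 2) / ?s (m + 1) * (y (m + 1))\<^sup>2 + ?s (m + 1) / ?s (m + 2) * (y (m + 2))\<^sup>2"
    using pos by (rule weighted_am_gm)
  with IH have "(\<Sum>i=1..m. 2 * y i * y (i + 1)) + 2 * y (m + 1) * y (m + 2)
      \<le> 2 * cos t * ((\<Sum>i=1..m. (y i)\<^sup>2) + (y (m + 1))\<^sup>2) + ?s (m + 1) / ?s (m + 2) * (y (m + 2))\<^sup>2"
    unfolding ratio left_diff_distrib distrib_left by linarith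
  then show ?case by (simp del: of_nat_Suc)
qed

lemma path_form_le:
  fixes y :: "nat \<Rightarrow> real"
  shows "(\<Sum>i=1..m. 2 * y i * y (i + 1)) \<le> 2 * cos (pi / real (m + 2)) * (\<Sum>i=1..m + 1. (y i)\<^sup>2)"
proof -
  define t where "t = pi / real (m + 2)"
  have pos: "sin (real i * t) > 0" if "1 \<le> i" "i \<le> m + 1" for i
    using that by (intro sin_gt_zero) (simp_all add: t_def divide_simps flip: distrib_left)
  \<comment> \<open>The eigenvector vanishes just beyond the last vertex \<open>m + 1\<close>, so
    the remainder coefficient of the auxiliary bound becomes \<open>2 * cos t\<close>.\<close>
  have "sin (real (m + 2) * t) = 0"
    by (simp add: t_def)
  then have "sin (real m * t) / sin (real (m + 1) * t) = 2 * cos t"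
    using sin_neighbours[of m t] pos[of "m + 1"] by (simp add: field_simps del: of_nat_add of_nat_Suc)
  then show ?thesis
    using path_form_le_aux[of m t y, OF pos] by (simp add: distrib_left t_def)
qed

lemma exp_partial_sum_deriv:
  fixes c :: "nat \<Rightarrow> real"
  shows "((\<lambda>x. \<Sum>k<Suc m. x ^ k / fact k * c k) has_real_derivative
     (\<Sum>k<m. x ^ k / fact k * c (Suc k))) (at x)"
proof -
  have "((\<lambda>x. x ^ Suc k / fact (Suc k) * c (Suc k)) has_real_derivative
      real (Suc k) * x ^ k / fact (Suc k) * c (Suc k)) (at x)" for k
    by (intro derivative_eq_intros) (auto simp del: power_Suc fact_Suc of_nat_Suc)
  then have "((\<lambda>x. x ^ Suc k / fact (Suc k) * c (Suc k)) has_real_derivative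
      x ^ k / fact k * c (Suc k)) (at x)" for k
    by (simp del: power_Suc of_nat_Suc)
  from DERIV_add[OF DERIV_const[of "c 0"] DERIV_sum[OF this]] show ?thesis
    by (simp add: sum.lessThan_Suc_shift del: sum.lessThan_Suc power_Suc fact_Suc)
qed

text \<open>The integrating factor \<open>exp (- (c * t))\<close> turns the differential inequality
  into monotonicity.\<close>

lemma gronwall_le:
  fixes f f' :: "real \<Rightarrow> real"
  assumes deriv: "\<And>t. (f has_real_derivative f' t) (at t)"
    and le: "\<And>t. f' t \<le> c * f t" and "x \<ge> 0"
  shows "f x \<le> exp (c * x) * f 0"
proof -
  have "((\<lambda>t. f t * exp (- (c * t))) has_real_derivative (f' t - c * f t) * exp (- (c * t))) (at t)" for t
    by (auto intro!: derivative_eq_intros deriv simp: algebra_simps)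
  moreover have "(f' t - c * f t) * exp (- (c * t)) \<le> 0" for t
    using le[of t] by (simp add: mult_nonpos_nonneg)
  ultimately have "f x * exp (- (c * x)) \<le> f 0 * exp (- (c * 0))"
    by (intro DERIV_nonpos_imp_nonincreasing[OF \<open>x \<ge> 0\<close>]) blast
  then show ?thesis
    by (simp add: exp_minus field_simps)
qed

theorem theorem3p2:
  fixes n :: nat and a :: "nat \<Rightarrow> real" and x :: real
  assumes "n \<ge> 1" and "x \<ge> 0"
  shows "(\<Sum>j=0..n - 1. (\<Sum>k=0..j. x ^ k / fact k * a (n - j + k))\<^sup>2)
           \<le> exp (2 * x * cos (pi / real (n + 1))) * (\<Sum>j=1..n. (a j)\<^sup>2)"
proof -
  obtain m where n: "n = m + 1"
    using \<open>n \<ge> 1\<close> by (metis add.commute le_Suc_ex)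
  \<comment> \<open>The strict bound makes \<open>b (n + 1)\<close> an empty sum; with
    \<open>k \<le> n - i\<close>, truncated subtraction would leave \<open>a (n + 1)\<close>
    there.\<close>
  define b where "b = (\<lambda>i x. \<Sum>k<n + 1 - i. x ^ k / fact k * a (i + k))"
  define E where "E = (\<lambda>x. \<Sum>i=1..n. (b i x)\<^sup>2)"
  have b_deriv: "(b i has_real_derivative b (i + 1) t) (at t)" if "i \<le> n" for i t
    using exp_partial_sum_deriv[of "\<lambda>k. a (i + k)" "n - i" t] that
    by (simp add: b_def Suc_diff_le del: sum.lessThan_Suc)
  have "(E has_real_derivative (\<Sum>i=1..n. 2 * b i t * b (i + 1) t)) (at t)" for t
    unfolding E_def by (auto intro!: derivative_eq_intros b_deriv sum.cong)
  moreover have "(\<Sum>i=1..n. 2 * b i t * b (i + 1) t) = (\<Sum>i=1..m. 2 * b i t * b (i + 1) t)" for t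
    by (simp add: n b_def)
  ultimately have E_deriv: "(E has_real_derivative (\<Sum>i=1..m. 2 * b i t * b (i + 1) t)) (at t)" for t
    by simp
  have E_le: "(\<Sum>i=1..m. 2 * b i t * b (i + 1) t) \<le> 2 * cos (pi / real (n + 1)) * E t" for t
    using path_form_le[of "\<lambda>i. b i t" m] by (simp add: E_def n)
  \<comment> \<open>At 0 only the term \<open>k = 0\<close> survives, since
    \<open>0 ^ 0 = 1\<close>.\<close>
  have "b i 0 = a i" if "i \<le> n" for i
    using that by (simp add: b_def Suc_diff_le sum.lessThan_Suc_shift del: sum.lessThan_Suc)
  then have E0: "E 0 = (\<Sum>j=1..n. (a j)\<^sup>2)"
    by (simp add: E_def)
  \<comment> \<open>The inner sum for \<open>j\<close> is \<open>b (n - j) x\<close>.\<close>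
  have "(\<Sum>j=0..n - 1. (\<Sum>k=0..j. x ^ k / fact k * a (n - j + k))\<^sup>2) = E x"
    unfolding E_def
    by (rule sum.reindex_bij_witness[where i = "\<lambda>i. n - i" and j = "\<lambda>j. n - j"])
      (auto simp: b_def n Suc_diff_le atLeast0AtMost lessThan_Suc_atMost)
  also have "\<dots> \<le> exp (2 * cos (pi / real (n + 1)) * x) * E 0"
    by (rule gronwall_le[OF E_deriv E_le \<open>x \<ge> 0\<close>])
  finally show ?thesis
    by (simp add: E0 mult.assoc mult.left_commute mult.commute)
qed

end
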